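(* Let $P(\lambda)=\sum_{i=0}^kP_i\,n_i(\lambda)$ be an $n\times n$ regular matrix polynomial expressed in the Newton basis associated with nodes $\{x_1,\ldots,x_k\}$, and let $\lambda_0$ be a finite eigenvalue of $P(\lambda)$. Let $0\le\mu\le k-1$ be an integer and let $\mathcal{N}_P^\mu(\lambda)=\begin{bmatrix}M_\mu^N(\lambda)&K_2^N(\lambda)^T\\ K_1^N(\lambda)&0\end{bmatrix}$. Then $z$ (resp. $\omega$) is a right (resp. left) eigenvector of $\mathcal{N}_P^\mu(\lambda)$ associated with $\lambda_0$ if and only if $z=H_N^\mu(\lambda_0)x$ (resp. $\omega=G_N^\mu(\lambda_0)^Ty$), where $x$ (resp. $y$) is a right (resp. left) eigenvector of $P(\lambda)$ associated with $\lambda_0$.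
   Context: Newton setting (here $m=n$). Let $k\ge1$ and $x_1,\ldots,x_k\in\mathbb{C}$ be distinct nodes. Put $\gamma_j(\lambda)=\lambda-x_j$, and $n_i^j(\lambda)=\prod_{\ell=i}^j\gamma_\ell(\lambda)$ if $j\ge i$, $n_i^j(\lambda)=1$ if $j<i$. The Newton polynomials are $n_0(\lambda)=1$, $n_j(\lambda)=n_1^j(\lambda)$. For $0\le\mu\le k-1$, $$K_1^N(\lambda)=\begin{bmatrix}-I_n&\gamma_{k-1}(\lambda)I_n\\&-I_n&\gamma_{k-2}(\lambda)I_n\\&&\ddots&\ddots\\&&&-I_n&\gamma_{\mu+1}(\lambda)I_n\end{bmatrix},\quad K_2^N(\lambda)=\begin{bmatrix}-I_n&\gamma_{\mu}(\lambda)I_n\\&-I_n&\gamma_{\mu-1}(\lambda)I_n\\&&\ddots&\ddots\\&&&-I_n&\gamma_{1}(\lambda)I_n\end{bmatrix},$$ of sizes $(k-\mu-1)n\times(k-\mu)n$ and $\mu n\times(\mu+1)n$ ($K_1^N$ is empty if $\mu=k-1$, $K_2^N$ is empty if $\mu=0$). $M_\mu^N(\lambda)$ is the $(\mu+1)\times(k-\mu)$ block matrix with $n\times n$ blocks: if $\mu\le k-2$, its first block row is $[\gamma_k(\lambda)P_k+P_{k-1},P_{k-2},\ldots,P_{\mu+1},P_\mu]$, its last block column has, from top to bottom, blocks $P_\mu,P_{\mu-1},\ldots,P_0$, and all other blocks are $0$; if $\mu=k-1$, it is the block column with blocks $\gamma_k(\lambda)P_k+P_{k-1},P_{k-2},\ldots,P_0$.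 Newton-Horner shifts: $P^i(\lambda)=P_k n_{k+1-i}^k(\lambda)+P_{k-1}n_{k+1-i}^{k-1}(\lambda)+\cdots+P_{k+1-i}n_{k+1-i}^{k+1-i}(\lambda)+P_{k-i}$ for $i=1,\ldots,k$. Let $D_1^N(\lambda)=[n_{\mu+1}^{k-1}(\lambda)I_n,\,n_{\mu+1}^{k-2}(\lambda)I_n,\ldots,n_{\mu+1}^{\mu+1}(\lambda)I_n,\,I_n]$ ($k-\mu$ blocks) and $D_2^N(\lambda)=[n_\mu(\lambda)I_n,n_{\mu-1}(\lambda)I_n,\ldots,n_1(\lambda)I_n,I_n]$ ($\mu+1$ blocks). $H_N^\mu(\lambda)$ is the block column obtained by stacking $D_1^N(\lambda)^T$ on top of $P^{k-\mu}(\lambda),P^{k-\mu+1}(\lambda),\ldots,P^{k-1}(\lambda)$ (just $D_1^N(\lambda)^T$ if $\mu=0$). $G_N^\mu(\lambda)$ is the block row $[D_2^N(\lambda),\,n_\mu(\lambda)P^1(\lambda),\,n_\mu(\lambda)P^2(\lambda),\ldots,n_\mu(\lambda)P^{k-\mu-1}(\lambda)]$ (just $D_2^N(\lambda)$ if $\mu=k-1$). A square matrix polynomial is regular if its determinant is not identically zero. $\lambda_0\in\mathbb{C}$ is a finite eigenvalue of $P$ if $P(\lambda_0)$ is singular; a right (left) eigenvector is a nonzero $x$ with $P(\lambda_0)x=0$ (nonzero $y$ with $y^TP(\lambda_0)=0$, plain transpose); the same for pencils. *)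

theory Defs
  imports "HOL-Computational_Algebra.Polynomial" "Jordan_Normal_Form.Matrix"
    "Jordan_Normal_Form.Determinant"
begin

text \<open>A matrix polynomial is a matrix with entries in \<^typ>\<open>complex poly\<close>.\<close>

definition eval_matpoly :: "complex poly mat \<Rightarrow> complex \<Rightarrow> complex mat" where
  "eval_matpoly A z = map_mat (\<lambda>p. poly p z) A"

definition regular_matpoly :: "complex poly mat \<Rightarrow> bool" where
  "regular_matpoly A \<longleftrightarrow> square_mat A \<and> det A \<noteq> 0"

definition finite_eigenvalue :: "complex poly mat \<Rightarrow> complex \<Rightarrow> bool" where
  "finite_eigenvalue A z \<longleftrightarrow> square_mat A \<and> \<not> invertible_mat (eval_matpoly A z)"

definition right_eigenvector :: "complex poly mat \<Rightarrow> complex \<Rightarrow> complex vec \<Rightarrow> bool" where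
  "right_eigenvector A z v \<longleftrightarrow>
     v \<in> carrier_vec (dim_col A) \<and> v \<noteq> 0\<^sub>v (dim_col A) \<and>
     eval_matpoly A z *\<^sub>v v = 0\<^sub>v (dim_row A)"

text \<open>The left eigenvector equation uses the plain (not the conjugate) transpose of the vector:
  \<^term>\<open>mat_of_row v\<close> is \<open>v\<close> written as a one-row matrix.\<close>

definition left_eigenvector :: "complex poly mat \<Rightarrow> complex \<Rightarrow> complex vec \<Rightarrow> bool" where
  "left_eigenvector A z v \<longleftrightarrow>
     v \<in> carrier_vec (dim_row A) \<and> v \<noteq> 0\<^sub>v (dim_row A) \<and>
     mat_of_row v * eval_matpoly A z = 0\<^sub>m 1 (dim_col A)"

text \<open>The matrix with \<open>r \<times> c\<close> blocks of size \<open>n \<times> n\<close>, the block in position \<open>(a, b)\<close> being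
  \<open>B a b\<close>. Block indices start at \<open>0\<close>.\<close>

definition block_matrix :: "nat \<Rightarrow> nat \<Rightarrow> nat \<Rightarrow> (nat \<Rightarrow> nat \<Rightarrow> 'a mat) \<Rightarrow> 'a mat" where
  "block_matrix n r c B =
     mat (r * n) (c * n) (\<lambda>(i, j). B (i div n) (j div n) $$ (i mod n, j mod n))"

text \<open>Side-by-side juxtaposition, the column counterpart of \<^const>\<open>append_rows\<close>.\<close>

definition append_columns :: "'a :: zero mat \<Rightarrow> 'a mat \<Rightarrow> 'a mat" where
  "append_columns A B = four_block_mat A B (0\<^sub>m 0 (dim_col A)) (0\<^sub>m 0 (dim_col B))"

text \<open>Entrywise sum of a family of \<open>n \<times> n\<close> matrices; \<^typ>\<open>'a mat\<close> has no single zero,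
  so \<^const>\<open>sum\<close> does not apply to it directly.\<close>

definition matrix_sum :: "nat \<Rightarrow> ('i \<Rightarrow> 'a :: comm_monoid_add mat) \<Rightarrow> 'i set \<Rightarrow> 'a mat" where
  "matrix_sum n F I = mat n n (\<lambda>ij. \<Sum>i\<in>I. F i $$ ij)"

definition const_matpoly :: "complex mat \<Rightarrow> complex poly mat" where
  "const_matpoly A = map_mat (\<lambda>a. [:a:]) A"

definition newton_gamma :: "(nat \<Rightarrow> complex) \<Rightarrow> nat \<Rightarrow> complex poly" where
  "newton_gamma x j = [:- x j, 1:]"

text \<open>\<open>newton_prod x i j\<close> is \<open>n\<^sub>i\<^sup>j\<close>; in particular \<open>newton_prod x 1 j\<close> is the Newton
  polynomial \<open>n\<^sub>j\<close>.\<close>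

definition newton_prod :: "(nat \<Rightarrow> complex) \<Rightarrow> nat \<Rightarrow> nat \<Rightarrow> complex poly" where
  "newton_prod x i j = (\<Prod>l\<in>{i..j}. newton_gamma x l)"

definition newton_matpoly ::
    "nat \<Rightarrow> nat \<Rightarrow> (nat \<Rightarrow> complex) \<Rightarrow> (nat \<Rightarrow> complex mat) \<Rightarrow> complex poly mat" where
  "newton_matpoly n k x P =
     matrix_sum n (\<lambda>i. newton_prod x 1 i \<cdot>\<^sub>m const_matpoly (P i)) {0..k}"

text \<open>The Newton-Horner shift \<open>P\<^sup>i\<close>, meant for \<open>1 \<le> i \<le> k\<close>.\<close>

definition newton_horner_shift ::
    "nat \<Rightarrow> nat \<Rightarrow> (nat \<Rightarrow> complex) \<Rightarrow> (nat \<Rightarrow> complex mat) \<Rightarrow> nat \<Rightarrow> complex poly mat" where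
  "newton_horner_shift n k x P i =
     matrix_sum n (\<lambda>l. newton_prod x (k + 1 - i) l \<cdot>\<^sub>m const_matpoly (P l)) {k + 1 - i..k}
     + const_matpoly (P (k - i))"

definition newton_K1 :: "nat \<Rightarrow> nat \<Rightarrow> nat \<Rightarrow> (nat \<Rightarrow> complex) \<Rightarrow> complex poly mat" where
  "newton_K1 n k \<mu> x = block_matrix n (k - \<mu> - 1) (k - \<mu>)
     (\<lambda>a b. if b = a then - 1\<^sub>m n
            else if b = a + 1 then newton_gamma x (k - 1 - a) \<cdot>\<^sub>m 1\<^sub>m n
            else 0\<^sub>m n n)"

definition newton_K2 :: "nat \<Rightarrow> nat \<Rightarrow> (nat \<Rightarrow> complex) \<Rightarrow> complex poly mat" where
  "newton_K2 n \<mu> x = block_matrix n \<mu> (\<mu> + 1)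
     (\<lambda>a b. if b = a then - 1\<^sub>m n
            else if b = a + 1 then newton_gamma x (\<mu> - a) \<cdot>\<^sub>m 1\<^sub>m n
            else 0\<^sub>m n n)"

text \<open>For \<open>\<mu> \<le> k - 2\<close> the first-row and last-column clauses agree on the top right corner, which
  is \<open>P\<^sub>\<mu>\<close>. For \<open>\<mu> = k - 1\<close> there is a single block column, so the last-column clause
  supplies every block below the first.\<close>

definition newton_M ::
    "nat \<Rightarrow> nat \<Rightarrow> nat \<Rightarrow> (nat \<Rightarrow> complex) \<Rightarrow> (nat \<Rightarrow> complex mat) \<Rightarrow> complex poly mat" where
  "newton_M n k \<mu> x P = block_matrix n (\<mu> + 1) (k - \<mu>)
     (\<lambda>a b. if a = 0 \<and> b = 0
              then newton_gamma x k \<cdot>\<^sub>m const_matpoly (P k) + const_matpoly (P (k - 1))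
            else if a = 0 then const_matpoly (P (k - 1 - b))
            else if b = k - \<mu> - 1 then const_matpoly (P (\<mu> - a))
            else 0\<^sub>m n n)"

definition newton_pencil ::
    "nat \<Rightarrow> nat \<Rightarrow> nat \<Rightarrow> (nat \<Rightarrow> complex) \<Rightarrow> (nat \<Rightarrow> complex mat) \<Rightarrow> complex poly mat" where
  "newton_pencil n k \<mu> x P =
     four_block_mat (newton_M n k \<mu> x P) (transpose_mat (newton_K2 n \<mu> x))
                    (newton_K1 n k \<mu> x) (0\<^sub>m ((k - \<mu> - 1) * n) (\<mu> * n))"

definition newton_D1 :: "nat \<Rightarrow> nat \<Rightarrow> nat \<Rightarrow> (nat \<Rightarrow> complex) \<Rightarrow> complex poly mat" where
  "newton_D1 n k \<mu> x =
     block_matrix n 1 (k - \<mu>) (\<lambda>_ b. newton_prod x (\<mu> + 1) (k - 1 - b) \<cdot>\<^sub>m 1\<^sub>m n)"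

definition newton_D2 :: "nat \<Rightarrow> nat \<Rightarrow> (nat \<Rightarrow> complex) \<Rightarrow> complex poly mat" where
  "newton_D2 n \<mu> x =
     block_matrix n 1 (\<mu> + 1) (\<lambda>_ b. newton_prod x 1 (\<mu> - b) \<cdot>\<^sub>m 1\<^sub>m n)"

definition newton_H ::
    "nat \<Rightarrow> nat \<Rightarrow> nat \<Rightarrow> (nat \<Rightarrow> complex) \<Rightarrow> (nat \<Rightarrow> complex mat) \<Rightarrow> complex poly mat" where
  "newton_H n k \<mu> x P =
     transpose_mat (newton_D1 n k \<mu> x) @\<^sub>r
     block_matrix n \<mu> 1 (\<lambda>a _. newton_horner_shift n k x P (k - \<mu> + a))"

definition newton_G ::
    "nat \<Rightarrow> nat \<Rightarrow> nat \<Rightarrow> (nat \<Rightarrow> complex) \<Rightarrow> (nat \<Rightarrow> complex mat) \<Rightarrow> complex poly mat" where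
  "newton_G n k \<mu> x P =
     append_columns (newton_D2 n \<mu> x)
       (block_matrix n 1 (k - \<mu> - 1)
          (\<lambda>_ b. newton_prod x 1 \<mu> \<cdot>\<^sub>m newton_horner_shift n k x P (b + 1)))"

end

theory Submission
  imports Defs
begin

text \<open>Evaluated at \<open>z\<^sub>0\<close>, the pencil has the shape \<open>[[B, K\<^sub>h\<^sup>T], [K\<^sub>g, 0]]\<close> with block bidiagonal
  \<open>K\<^sub>g\<close>, \<open>K\<^sub>h\<close> whose leading diagonal blocks are \<open>- I\<close>. The lower block rows of a null vector
  express each of its first blocks through the last of them, \<open>v\<close>, with scalar factors \<open>D b\<close>. The
  upper block rows then determine the remaining blocks one after the other as \<open>S a v\<close>, where \<open>S\<close>
  obeys a Horner recursion, and the last one leaves the condition \<open>S q v = 0\<close>. For the Newton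
  pencil that recursion produces the Horner shifts and \<open>S q = P(z\<^sub>0)\<close>. The transposed pencil has
  the same shape with the roles of \<open>K\<^sub>g\<close> and \<open>K\<^sub>h\<close> exchanged, which gives the left eigenvectors.\<close>

section \<open>Block matrices: indexing, transposition, gluing and products with vectors\<close>

lemma block_index_less:
  assumes "i < r * n" shows "i div n < r" "i mod n < (n::nat)"
  using assms by (auto simp: less_mult_imp_div_less intro!: mod_less_divisor gr0I)

lemma block_index_add: "a < r \<Longrightarrow> i < n \<Longrightarrow> a * n + i < r * (n::nat)"
  using mult_le_mono1[of "Suc a" r n] by simp

lemma block_matrix_dims [simp]:
  "dim_row (block_matrix n r c B) = r * n" "dim_col (block_matrix n r c B) = c * n"
  "block_matrix n r c B \<in> carrier_mat (r * n) (c * n)"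
  by (simp_all add: block_matrix_def)

lemma block_matrix_cong:
  assumes "\<And>a b. a < r \<Longrightarrow> b < c \<Longrightarrow> B a b = C a b"
  shows "block_matrix n r c B = block_matrix n r c C"
  using assms by (auto simp: block_matrix_def block_index_less)

text \<open>Entries of a matrix outside its dimensions are unspecified, so \<open>f\<close> passes
  to the blocks only because each of them is known to be \<open>n\<close> by
  \<open>n\<close>.\<close>

lemma map_block_matrix:
  assumes "\<And>a b. a < r \<Longrightarrow> b < c \<Longrightarrow> B a b \<in> carrier_mat n n"
  shows "map_mat f (block_matrix n r c B) = block_matrix n r c (\<lambda>a b. map_mat f (B a b))"
proof (rule eq_matI, goal_cases)
  case (1 i j)
  then have ij: "i < r * n" "j < c * n" by simp_all
  then show ?case
    using assms[of "i div n" "j div n"] block_index_less[OF ij(1)] block_index_less[OF ij(2)]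
    by (auto simp: block_matrix_def)
qed simp_all

lemma transpose_block_matrix:
  assumes "\<And>a b. a < r \<Longrightarrow> b < c \<Longrightarrow> B a b \<in> carrier_mat n n"
  shows "transpose_mat (block_matrix n r c B) =
    block_matrix n c r (\<lambda>a b. transpose_mat (B b a))"
proof (rule eq_matI, goal_cases)
  case (1 j i)
  then have ij: "i < r * n" "j < c * n" by simp_all
  then show ?case
    using assms[of "i div n" "j div n"] block_index_less[OF ij(1)] block_index_less[OF ij(2)]
    by (auto simp: block_matrix_def)
qed simp_all

text \<open>Flattens four glued block matrices into one block function, so that the pencil and the
  stacked columns can be multiplied by a vector block by block. Beyond the seam, removing
  \<open>r * n\<close> from an index lowers its block number by \<open>r\<close> and keeps its
  position inside the block.\<close>

lemma four_block_block_matrix: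
  "four_block_mat (block_matrix n r c A) (block_matrix n r c' B)
      (block_matrix n r' c C) (block_matrix n r' c' D) =
    block_matrix n (r + r') (c + c') (\<lambda>a b.
      if a < r then if b < c then A a b else B a (b - c)
      else if b < c then C (a - r) b else D (a - r) (b - c))"
  (is "?L = ?R")
proof (rule eq_matI, goal_cases)
  case (1 i j)
  then have ij: "i < (r + r') * n" "j < (c + c') * n" by simp_all
  \<comment> \<open>\<open>div\<close> and \<open>mod\<close> by \<open>n\<close> behave as block
    number and offset only for positive \<open>n\<close>; the existence of an index in range ensures
    this.\<close>
  then have n: "n > 0" by (cases n) auto
  have less: "(i div n < r) = (i < r * n)" for i r
    using n by (simp add: div_less_iff_less_mult)
  have shift: "(i - r * n) div n = i div n - r" "(i - r * n) mod n = i mod n"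
    if "\<not> i < r * n" for i r
  proof -
    from that obtain d where "i = r * n + d" by (metis le_Suc_ex not_less)
    then show "(i - r * n) div n = i div n - r" "(i - r * n) mod n = i mod n"
      using n by simp_all
  qed
  show ?case
    using ij by (simp add: block_matrix_def less shift distrib_right)
qed (simp_all add: algebra_simps)

lemma zero_block_matrix:
  "0\<^sub>m (r * n) (c * n) = block_matrix n r c (\<lambda>a b. 0\<^sub>m n n)"
  by (rule eq_matI) (auto simp: block_matrix_def block_index_less)

lemma sum_blocks:
  fixes f :: "nat \<Rightarrow> 'a :: comm_monoid_add"
  shows "(\<Sum>j<c * n. f j) = (\<Sum>b<c. \<Sum>j<n. f (b * n + j))"
  unfolding sum.nat_group[symmetric]
  by (simp add: sum.atLeastLessThan_shift_0[of f] comp_def lessThan_atLeast0)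

lemma block_matrix_mult_vec_index:
  assumes "z \<in> carrier_vec (c * n)" "a < r" "i < n"
  shows "(block_matrix n r c B *\<^sub>v z) $ (a * n + i) =
    (\<Sum>b<c. \<Sum>j<n. B a b $$ (i, j) * z $ (b * n + j))"
proof -
  have "(block_matrix n r c B *\<^sub>v z) $ (a * n + i) =
      (\<Sum>j<c * n. B a (j div n) $$ (i, j mod n) * z $ j)"
    using assms block_index_add[OF assms(2,3)]
    by (simp add: block_matrix_def scalar_prod_def lessThan_atLeast0)
  also have "\<dots> = (\<Sum>b<c. \<Sum>j<n. B a b $$ (i, j) * z $ (b * n + j))"
    unfolding sum_blocks by (intro sum.cong refl) auto
  finally show ?thesis .
qed

lemma block_vec_eqI:
  assumes "v \<in> carrier_vec (r * n)" "w \<in> carrier_vec (r * n)"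
    and "\<And>a i. a < r \<Longrightarrow> i < n \<Longrightarrow> v $ (a * n + i) = w $ (a * n + i)"
  shows "v = w"
proof (rule eq_vecI)
  fix l assume "l < dim_vec w"
  then have "l < r * n" using assms(2) by simp
  from assms(3)[OF block_index_less[OF this]] show "v $ l = w $ l" by simp
qed (use assms in simp)

text \<open>The left side has the shape of a row coming from \<open>four_block_block_matrix\<close>;
  the sum separates at the seam.\<close>

lemma sum_if_less_shift:
  fixes f g :: "nat \<Rightarrow> 'a :: comm_monoid_add"
  shows "(\<Sum>b<m + q. if b < m then f b else g (b - m)) = (\<Sum>b<m. f b) + (\<Sum>b<q. g b)"
  by (induction q) (simp_all add: add.assoc)

section \<open>Block bidiagonal matrices and the pencils built from them\<close>

text \<open>A single block rather than the whole matrix, so that it serves as the block function of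
  \<open>block_matrix\<close>. Both \<open>newton_K1\<close> and \<open>newton_K2\<close> arise from
  it by a choice of \<open>g\<close>.\<close>

definition bidiag :: "nat \<Rightarrow> (nat \<Rightarrow> 'a :: ring_1) \<Rightarrow> nat \<Rightarrow> nat \<Rightarrow> 'a mat" where
  "bidiag n g a b = (if b = a then - 1\<^sub>m n else if b = a + 1 then g a \<cdot>\<^sub>m 1\<^sub>m n else 0\<^sub>m n n)"

lemma bidiag_carrier [simp]: "bidiag n g a b \<in> carrier_mat n n"
  by (simp add: bidiag_def)

lemma bidiag_index:
  "i < n \<Longrightarrow> j < n \<Longrightarrow> bidiag n g a b $$ (i, j) =
    (if i = j then if b = a then - 1 else if b = a + 1 then g a else 0 else 0)"
  by (simp add: bidiag_def)

text \<open>Block row \<open>a\<close> meets only block columns \<open>a\<close> and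
  \<open>a + 1\<close>, and both exist because \<open>a < q\<close>. Here \<open>r b j\<close>
  stands for entry \<open>j\<close> of block \<open>b\<close> of a vector.\<close>

lemma bidiag_row_sum:
  fixes g :: "nat \<Rightarrow> 'a :: comm_ring_1"
  assumes "a < q" "i < n"
  shows "(\<Sum>b<q + 1. \<Sum>j<n. bidiag n g a b $$ (i, j) * r b j) = g a * r (a + 1) i - r a i"
proof -
  have "(\<Sum>j<n. bidiag n g a b $$ (i, j) * r b j) =
      (if b = a then - r b i else 0) + (if b = a + 1 then g a * r b i else 0)" for b
  proof -
    have "(\<Sum>j<n. bidiag n g a b $$ (i, j) * r b j) =
      (\<Sum>j<n. if j = i then (if b = a then - 1 else if b = a + 1 then g a else 0) * r b j else 0)"
      using assms by (intro sum.cong refl) (simp add: bidiag_index)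
    then show ?thesis using assms by simp
  qed
  then show ?thesis using assms by (simp only: sum.distrib) (simp add: sum.delta)
qed

text \<open>The transpose has one block row more than it has block columns, so one of the two terms
  is missing at each end: row \<open>0\<close> has no superdiagonal block, row \<open>q\<close> no
  diagonal block.\<close>

lemma bidiag_column_sum:
  fixes g :: "nat \<Rightarrow> 'a :: comm_ring_1"
  assumes "a \<le> q" "i < n"
  shows "(\<Sum>b<q. \<Sum>j<n. transpose_mat (bidiag n g b a) $$ (i, j) * t b j) =
    (if a = 0 then 0 else g (a - 1) * t (a - 1) i) - (if a < q then t a i else 0)"
proof -
  \<comment> \<open>For \<open>a = 0\<close> truncated subtraction makes \<open>a - 1\<close> equal
    to \<open>0\<close>, hence the inner guard.\<close>
  have "(\<Sum>j<n. transpose_mat (bidiag n g b a) $$ (i, j) * t b j) =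
      (if b = a then - t b i else 0) + (if b = a - 1 then if a = 0 then 0 else g b * t b i else 0)" for b
  proof -
    have "(\<Sum>j<n. transpose_mat (bidiag n g b a) $$ (i, j) * t b j) =
      (\<Sum>j<n. if j = i then (if a = b then - 1 else if a = b + 1 then g b else 0) * t b j else 0)"
      using assms carrier_matD[OF bidiag_carrier[of n g b a]]
      by (intro sum.cong refl) (simp add: bidiag_index)
    then show ?thesis using assms by auto
  qed
  then show ?thesis using assms by (simp only: sum.distrib) (auto simp add: sum.delta)
qed

text \<open>\<open>p\<close> and \<open>q\<close> are the numbers of block rows of \<open>K\<^sub>g\<close> and \<open>K\<^sub>h\<close>, respectively.\<close>

definition bidiag_pencil ::
    "nat \<Rightarrow> nat \<Rightarrow> nat \<Rightarrow> (nat \<Rightarrow> 'a :: ring_1) \<Rightarrow> (nat \<Rightarrow> 'a) \<Rightarrow> (nat \<Rightarrow> nat \<Rightarrow> 'a mat) \<Rightarrow> 'a mat" where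
  "bidiag_pencil n p q g h B =
     four_block_mat (block_matrix n (q + 1) (p + 1) B)
       (transpose_mat (block_matrix n q (q + 1) (bidiag n h)))
       (block_matrix n p (p + 1) (bidiag n g)) (0\<^sub>m (p * n) (q * n))"

lemma bidiag_pencil_dims [simp]:
  "dim_row (bidiag_pencil n p q g h B) = (q + 1) * n + p * n"
  "dim_col (bidiag_pencil n p q g h B) = (p + 1) * n + q * n"
  by (simp_all add: bidiag_pencil_def)

lemma transpose_bidiag_pencil:
  assumes "\<And>a b. a \<le> q \<Longrightarrow> b \<le> p \<Longrightarrow> B a b \<in> carrier_mat n n"
  shows "transpose_mat (bidiag_pencil n p q g h B) =
    bidiag_pencil n q p h g (\<lambda>a b. transpose_mat (B b a))"
proof -
  have "transpose_mat (block_matrix n (q + 1) (p + 1) B) =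
      block_matrix n (p + 1) (q + 1) (\<lambda>a b. transpose_mat (B b a))"
    by (intro transpose_block_matrix assms) auto
  then show ?thesis unfolding bidiag_pencil_def
    by (subst transpose_four_block_mat[of _ "(q+1)*n" "(p+1)*n" _ "q*n" _ "p*n"])
      (simp_all add: transpose_mat_def[of "0\<^sub>m _ _"] zero_mat_def, auto)
qed

lemma bidiag_pencil_eq_block:
  "bidiag_pencil n p q g h B = block_matrix n (q + 1 + p) (p + 1 + q) (\<lambda>a b.
     if a < q + 1 then if b < p + 1 then B a b else transpose_mat (bidiag n h (b - (p + 1)) a)
     else if b < p + 1 then bidiag n g (a - (q + 1)) b else 0\<^sub>m n n)"
  unfolding bidiag_pencil_def
  by (simp only: transpose_block_matrix[OF bidiag_carrier] zero_block_matrix four_block_block_matrix)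

text \<open>Blocks \<open>0\<close> to \<open>p\<close> of the vector meet \<open>B\<close> and
  \<open>K\<^sub>g\<close>, the later ones only the transpose of \<open>K\<^sub>h\<close>. Each
  upper row links two consecutive later blocks; each lower row links two consecutive earlier
  ones.\<close>

lemma bidiag_pencil_mult_vec_index:
  fixes z :: "'a :: comm_ring_1 vec"
  assumes "z \<in> carrier_vec ((p + 1 + q) * n)" "i < n"
  shows "a \<le> q \<Longrightarrow> (bidiag_pencil n p q g h B *\<^sub>v z) $ (a * n + i) =
      (\<Sum>b<p + 1. \<Sum>j<n. B a b $$ (i, j) * z $ (b * n + j)) +
      ((if a = 0 then 0 else h (a - 1) * z $ ((p + 1 + (a - 1)) * n + i)) -
       (if a < q then z $ ((p + 1 + a) * n + i) else 0))" (is "_ \<Longrightarrow> ?top")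
    and "a < p \<Longrightarrow> (bidiag_pencil n p q g h B *\<^sub>v z) $ ((q + 1 + a) * n + i) =
      g a * z $ ((a + 1) * n + i) - z $ (a * n + i)" (is "_ \<Longrightarrow> ?bot")
proof -
  have split: "(\<Sum>b<p + 1 + q. \<Sum>j<n. (if b < p + 1 then X b else Y (b - (p + 1))) $$ (i, j) * z $ (b * n + j)) =
    (\<Sum>b<p + 1. \<Sum>j<n. X b $$ (i, j) * z $ (b * n + j)) +
    (\<Sum>b<q. \<Sum>j<n. Y b $$ (i, j) * z $ ((p + 1 + b) * n + j))" for X Y :: "nat \<Rightarrow> 'a mat"
    unfolding sum_if_less_shift[symmetric] by (intro sum.cong refl) auto
  show ?top if "a \<le> q"
  proof -
    have "(bidiag_pencil n p q g h B *\<^sub>v z) $ (a * n + i) =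
      (\<Sum>b<p + 1 + q. \<Sum>j<n. (if b < p + 1 then B a b else transpose_mat (bidiag n h (b - (p + 1)) a)) $$ (i, j) * z $ (b * n + j))"
      unfolding bidiag_pencil_eq_block using that
      by (subst block_matrix_mult_vec_index[OF assms(1) _ assms(2)]) auto
    then show ?thesis unfolding split[of "B a" "\<lambda>b. transpose_mat (bidiag n h b a)"]
      by (simp only: bidiag_column_sum[OF that assms(2)])
  qed
  show ?bot if "a < p"
  proof -
    have "(bidiag_pencil n p q g h B *\<^sub>v z) $ ((q + 1 + a) * n + i) =
      (\<Sum>b<p + 1 + q. \<Sum>j<n. (if b < p + 1 then bidiag n g a b else 0\<^sub>m n n) $$ (i, j) * z $ (b * n + j))"
      unfolding bidiag_pencil_eq_block using that
      by (subst block_matrix_mult_vec_index[OF assms(1) _ assms(2)])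
        (auto simp del: sum.lessThan_Suc intro!: sum.cong)
    then show ?thesis unfolding split[of "bidiag n g a" "\<lambda>_. 0\<^sub>m n n"] bidiag_row_sum[OF that assms(2)]
      using assms(2) by simp
  qed
qed

section \<open>The null space of a bidiagonal pencil\<close>

text \<open>Common form of \<open>newton_H\<close> and of the transpose of \<open>newton_G\<close>.
  Only \<open>S 0\<close> to \<open>S (q - 1)\<close> occur in it; \<open>S q\<close> is reserved
  for the condition on \<open>v\<close>.\<close>

definition block_column ::
    "nat \<Rightarrow> nat \<Rightarrow> nat \<Rightarrow> (nat \<Rightarrow> 'a :: semiring_1) \<Rightarrow> (nat \<Rightarrow> 'a mat) \<Rightarrow> 'a mat" where
  "block_column n p q D S =
     block_matrix n (p + 1 + q) 1 (\<lambda>a _. if a \<le> p then D a \<cdot>\<^sub>m 1\<^sub>m n else S (a - (p + 1)))"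

lemma block_column_dims [simp]:
  "dim_row (block_column n p q D S) = (p + 1 + q) * n" "dim_col (block_column n p q D S) = n"
  by (simp_all add: block_column_def)

lemma block_column_mult_vec_index:
  fixes v :: "'a :: comm_ring_1 vec"
  assumes "v \<in> carrier_vec n" "i < n"
  shows "a \<le> p \<Longrightarrow> (block_column n p q D S *\<^sub>v v) $ (a * n + i) = D a * v $ i"
    and "a < q \<Longrightarrow> (block_column n p q D S *\<^sub>v v) $ ((p + 1 + a) * n + i) =
      (\<Sum>j<n. S a $$ (i, j) * v $ j)"
proof -
  have v: "v \<in> carrier_vec (1 * n)" using assms by simp
  show "(block_column n p q D S *\<^sub>v v) $ (a * n + i) = D a * v $ i" if "a \<le> p"
  proof -
    have "(block_column n p q D S *\<^sub>v v) $ (a * n + i) = (\<Sum>j<n. (D a \<cdot>\<^sub>m 1\<^sub>m n) $$ (i, j) * v $ j)"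
      unfolding block_column_def using that
      by (subst block_matrix_mult_vec_index[OF v _ assms(2)]) simp_all
    also have "\<dots> = (\<Sum>j<n. if j = i then D a * v $ j else 0)"
      using assms by (intro sum.cong refl) auto
    finally show ?thesis using assms by simp
  qed
  show "(block_column n p q D S *\<^sub>v v) $ ((p + 1 + a) * n + i) = (\<Sum>j<n. S a $$ (i, j) * v $ j)"
    if "a < q"
    unfolding block_column_def using that
    by (subst block_matrix_mult_vec_index[OF v _ assms(2)]) simp_all
qed

text \<open>The hypotheses on \<open>D\<close> are the lower block rows, solved from block
  \<open>p\<close> downwards. Those on \<open>S\<close> are the upper block rows with
  \<open>D b\<close> times \<open>v\<close> put in for block \<open>b\<close>, so that solving for
  the later blocks one by one reproduces \<open>S a\<close> applied to \<open>v\<close>.\<close>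

lemma bidiag_pencil_kernel:
  fixes z :: "'a :: comm_ring_1 vec"
  assumes z: "z \<in> carrier_vec ((p + 1 + q) * n)"
    and D: "D p = 1" "\<And>a. a < p \<Longrightarrow> D a = g a * D (Suc a)"
    and S: "\<And>a. a \<le> q \<Longrightarrow> S a \<in> carrier_mat n n"
    and S_0: "\<And>i j. i < n \<Longrightarrow> j < n \<Longrightarrow> S 0 $$ (i, j) = (\<Sum>b<p + 1. D b * B 0 b $$ (i, j))"
    and S_Suc: "\<And>a i j. a < q \<Longrightarrow> i < n \<Longrightarrow> j < n \<Longrightarrow>
      S (Suc a) $$ (i, j) = h a * S a $$ (i, j) + (\<Sum>b<p + 1. D b * B (Suc a) b $$ (i, j))"
  shows "bidiag_pencil n p q g h B *\<^sub>v z = 0\<^sub>v ((p + 1 + q) * n) \<longleftrightarrow>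
    (\<exists>v\<in>carrier_vec n. S q *\<^sub>v v = 0\<^sub>v n \<and> z = block_column n p q D S *\<^sub>v v)"
    (is "?L \<longleftrightarrow> ?R")
proof -
  \<comment> \<open>\<open>v\<close> is the last of the first \<open>p + 1\<close> blocks of
    \<open>z\<close>, \<open>r\<close> lists those blocks and \<open>t\<close> the remaining
    \<open>q\<close>. \<open>T w a\<close> is \<open>S a\<close> applied to \<open>w\<close>, and
    \<open>c a\<close> is the contribution of \<open>B\<close> to upper row
    \<open>a\<close>.\<close>
  define v where "v = vec n (\<lambda>i. z $ (p * n + i))"
  define r where "r a i = z $ (a * n + i)" for a i
  define t where "t a i = z $ ((p + 1 + a) * n + i)" for a i
  define T where "T w a i = (\<Sum>j<n. S a $$ (i, j) * w $ j)" for w a i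
  define c where "c a i = (\<Sum>b<p + 1. \<Sum>j<n. B a b $$ (i, j) * z $ (b * n + j))" for a i
  have v: "v \<in> carrier_vec n" by (simp add: v_def)
  have top: "(bidiag_pencil n p q g h B *\<^sub>v z) $ (a * n + i) =
      c a i + (if a = 0 then 0 else h (a - 1) * t (a - 1) i) - (if a < q then t a i else 0)"
    if "a \<le> q" "i < n" for a i
    unfolding bidiag_pencil_mult_vec_index(1)[OF z that(2,1)] by (simp only: c_def t_def add_diff_eq)
  \<comment> \<open>The matrix equation read entry by entry: \<open>?K i\<close> collects the lower
    block rows, \<open>?M i\<close> the upper ones.\<close>
  have L: "?L \<longleftrightarrow>
    (\<forall>i<n. (\<forall>a<p. r a i = g a * r (Suc a) i) \<and>
      (\<forall>a\<le>q. c a i + (if a = 0 then 0 else h (a - 1) * t (a - 1) i) = (if a < q then t a i else 0)))"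
    (is "_ \<longleftrightarrow> (\<forall>i<n. ?K i \<and> ?M i)")
  proof
    assume ?L
    then have 0: "(bidiag_pencil n p q g h B *\<^sub>v z) $ l = 0" if "l < (p + 1 + q) * n" for l
      using that by simp
    show "\<forall>i<n. ?K i \<and> ?M i"
    proof (intro allI impI conjI)
      fix i a assume "i < n" "a < p"
      then show "r a i = g a * r (Suc a) i"
        using bidiag_pencil_mult_vec_index(2)[OF z, of i a g h B] 0[OF block_index_add[of "q + 1 + a" _ i]]
        by (simp add: r_def)
    next
      fix i a assume "i < n" "a \<le> q"
      then show "c a i + (if a = 0 then 0 else h (a - 1) * t (a - 1) i) = (if a < q then t a i else 0)"
        using top[of a i] 0[OF block_index_add[of a _ i]] by simp
    qed
  next
    assume *: "\<forall>i<n. ?K i \<and> ?M i"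
    show ?L
    proof (rule block_vec_eqI[of _ "p + 1 + q" n])
      fix a i assume a: "a < p + 1 + q" and i: "i < n"
      show "(bidiag_pencil n p q g h B *\<^sub>v z) $ (a * n + i) = 0\<^sub>v ((p + 1 + q) * n) $ (a * n + i)"
      proof (cases "a \<le> q")
        case True
        then have "c a i + (if a = 0 then 0 else h (a - 1) * t (a - 1) i) - (if a < q then t a i else 0) = 0"
          using * i by simp
        then show ?thesis
          unfolding top[OF True i] using block_index_add[OF a i] by simp
      next
        case False
        define b where "b = a - (q + 1)"
        with False a have b: "a = q + 1 + b" "b < p" by auto
        then have "r b i = g b * r (Suc b) i" using * i by simp
        then show ?thesis
          unfolding b(1) bidiag_pencil_mult_vec_index(2)[OF z i b(2), folded r_def]
          using block_index_add[OF a i] b by (simp add: r_def)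
      qed
    qed (auto intro!: carrier_vecI simp: distrib_right)
  qed
  have K: "?K i \<longleftrightarrow> (\<forall>a\<le>p. r a i = D a * v $ i)" if i: "i < n" for i
  proof
    assume K: "?K i"
    show "\<forall>a\<le>p. r a i = D a * v $ i"
    proof (intro allI impI)
      fix a assume "a \<le> p"
      then show "r a i = D a * v $ i"
        \<comment> \<open>The induction descends from \<open>a = p\<close>, where
          \<open>D p = 1\<close> and block \<open>p\<close> is \<open>v\<close> by
          definition.\<close>
        by (induction rule: inc_induct) (use K D i in \<open>simp_all add: v_def r_def mult.assoc\<close>)
    qed
  next
    assume R: "\<forall>a\<le>p. r a i = D a * v $ i"
    show "?K i" using R D by (simp add: mult.assoc)
  qed
  \<comment> \<open>Once the first blocks are multiples of \<open>v\<close>, \<open>c a\<close> is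
    the sum of the \<open>D b\<close> times \<open>B a b\<close>, applied to \<open>v\<close>. The
    recursion for \<open>S\<close> thus becomes one for \<open>T v\<close>, of the same form as the
    upper rows.\<close>
  have T_0: "T v 0 i = c 0 i"
    and T_Suc: "a < q \<Longrightarrow> T v (Suc a) i = h a * T v a i + c (Suc a) i"
    if i: "i < n" and R: "\<And>i a. i < n \<Longrightarrow> a \<le> p \<Longrightarrow> r a i = D a * v $ i" for a i
  proof -
    have c: "c a i = (\<Sum>j<n. (\<Sum>b<p + 1. D b * B a b $$ (i, j)) * v $ j)" for a
      unfolding c_def r_def[symmetric]
      by (subst sum.swap, intro sum.cong refl, unfold sum_distrib_right, intro sum.cong refl)
        (simp add: R algebra_simps)
    show "T v 0 i = c 0 i"
      unfolding c T_def by (intro sum.cong refl) (simp add: S_0 i)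
    show "T v (Suc a) i = h a * T v a i + c (Suc a) i" if "a < q"
      unfolding c T_def sum_distrib_left sum.distrib[symmetric]
      by (intro sum.cong refl) (simp add: S_Suc i that algebra_simps)
  qed
  have M: "?M i \<longleftrightarrow> (\<forall>a<q. t a i = T v a i) \<and> T v q i = 0"
    if i: "i < n" and R: "\<And>i a. i < n \<Longrightarrow> a \<le> p \<Longrightarrow> r a i = D a * v $ i" for i
  proof
    assume M: "?M i"
    \<comment> \<open>Treating the absent block number \<open>q\<close> as zero lets one induction
      yield both the values of \<open>t\<close> and the final condition
      \<open>T v q i = 0\<close>.\<close>
    have "T v a i = (if a < q then t a i else 0)" if "a \<le> q" for a
      using that
    proof (induction a)
      case 0
      then show ?case using M[rule_format, of 0] T_0[OF i R] by simp
    next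
      case (Suc a)
      then show ?case using M[rule_format, of "Suc a"] T_Suc[OF i R, of a] by (simp add: add.commute)
    qed
    then show "(\<forall>a<q. t a i = T v a i) \<and> T v q i = 0" by simp
  next
    assume *: "(\<forall>a<q. t a i = T v a i) \<and> T v q i = 0"
    show "?M i"
    proof (intro allI impI)
      fix a assume a: "a \<le> q"
      show "c a i + (if a = 0 then 0 else h (a - 1) * t (a - 1) i) = (if a < q then t a i else 0)"
      proof (cases a)
        case 0
        then show ?thesis using * T_0[OF i R] by auto
      next
        case (Suc b)
        then show ?thesis using * a T_Suc[OF i R, of b] by (cases "Suc b = q") (auto simp: add.commute)
      qed
    qed
  qed
  have S_mult: "S q *\<^sub>v w = 0\<^sub>v n \<longleftrightarrow> (\<forall>i<n. T w q i = 0)" if "w \<in> carrier_vec n" for w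
    using S[of q] that
    by (auto simp: vec_eq_iff T_def scalar_prod_def lessThan_atLeast0)
  have "?R \<longleftrightarrow> (\<forall>i<n. (\<forall>a\<le>p. r a i = D a * v $ i) \<and> (\<forall>a<q. t a i = T v a i) \<and> T v q i = 0)"
  proof
    assume ?R
    then obtain w where w: "w \<in> carrier_vec n" "S q *\<^sub>v w = 0\<^sub>v n" "z = block_column n p q D S *\<^sub>v w"
      by blast
    \<comment> \<open>Block \<open>p\<close> of the column applied to \<open>w\<close> is
      \<open>w\<close> itself, since \<open>D p = 1\<close>.\<close>
    have "v = w"
      using w(1) block_column_mult_vec_index(1)[OF w(1), of _ p p q D S] D
      by (auto simp: vec_eq_iff v_def w(3))
    then show "\<forall>i<n. (\<forall>a\<le>p. r a i = D a * v $ i) \<and> (\<forall>a<q. t a i = T v a i) \<and> T v q i = 0"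
      using w S_mult[OF w(1)] block_column_mult_vec_index[OF w(1)]
      by (auto simp: r_def t_def T_def)
  next
    assume *: "\<forall>i<n. (\<forall>a\<le>p. r a i = D a * v $ i) \<and> (\<forall>a<q. t a i = T v a i) \<and> T v q i = 0"
    have "z = block_column n p q D S *\<^sub>v v"
    proof (rule block_vec_eqI[of _ "p + 1 + q" n])
      fix a i assume a: "a < p + 1 + q" and i: "i < n"
      show "z $ (a * n + i) = (block_column n p q D S *\<^sub>v v) $ (a * n + i)"
      proof (cases "a \<le> p")
        case True
        then show ?thesis
          using * i block_column_mult_vec_index(1)[OF v i True] by (simp add: r_def)
      next
        case False
        define b where "b = a - (p + 1)"
        with False a have b: "a = p + 1 + b" "b < q" by auto
        then show ?thesis
          using * i block_column_mult_vec_index(2)[OF v i b(2)] by (simp add: t_def T_def)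
      qed
    qed (use z in \<open>auto intro!: carrier_vecI\<close>)
    then show ?R using * S_mult[OF v] v by blast
  qed
  \<comment> \<open>\<open>M\<close> presupposes that the first blocks are multiples of
    \<open>v\<close>. If they are not, both sides are false, the left one by
    \<open>K\<close>.\<close>
  moreover have "(\<forall>i<n. ?K i \<and> ?M i) \<longleftrightarrow>
      (\<forall>i<n. (\<forall>a\<le>p. r a i = D a * v $ i) \<and> (\<forall>a<q. t a i = T v a i) \<and> T v q i = 0)"
  proof (cases "\<forall>i<n. \<forall>a\<le>p. r a i = D a * v $ i")
    case True
    then have "?K i" "?M i \<longleftrightarrow> (\<forall>a<q. t a i = T v a i) \<and> T v q i = 0" if "i < n" for i
      using K[OF that] M[OF that] that by simp_all
    with True show ?thesis by simp
  next
    case False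
    with K show ?thesis by meson
  qed
  ultimately show ?thesis using L by simp
qed

text \<open>Block \<open>p\<close> of the product is \<open>v\<close>, because
  \<open>D p = 1\<close>; hence the column is injective and preserves nonzero vectors.\<close>

lemma block_column_mult_vec_eq_0_iff:
  fixes v :: "'a :: comm_ring_1 vec"
  assumes "v \<in> carrier_vec n" "D p = 1"
  shows "block_column n p q D S *\<^sub>v v = 0\<^sub>v ((p + 1 + q) * n) \<longleftrightarrow> v = 0\<^sub>v n"
proof
  assume 0: "block_column n p q D S *\<^sub>v v = 0\<^sub>v ((p + 1 + q) * n)"
  have "v $ i = 0" if "i < n" for i
    using block_column_mult_vec_index(1)[OF assms(1) that, of p p q D S] assms(2) 0
      block_index_add[of p "p + 1 + q" i n] that by simp
  then show "v = 0\<^sub>v n" using assms(1) by (intro eq_vecI) auto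
next
  assume "v = 0\<^sub>v n"
  then show "block_column n p q D S *\<^sub>v v = 0\<^sub>v ((p + 1 + q) * n)"
    by (intro eq_vecI) (simp_all add: scalar_prod_def block_column_def block_matrix_def)
qed

text \<open>Combines the kernel description with injectivity. The carrier and nonzero conditions
  stand inside the equivalence so that both sides match the unfolded
  \<open>right_eigenvector\<close>.\<close>

lemma bidiag_pencil_null_vector_iff:
  fixes z :: "'a :: comm_ring_1 vec"
  assumes D: "D p = 1" "\<And>a. a < p \<Longrightarrow> D a = g a * D (Suc a)"
    and S: "\<And>a. a \<le> q \<Longrightarrow> S a \<in> carrier_mat n n"
    and S_0: "\<And>i j. i < n \<Longrightarrow> j < n \<Longrightarrow> S 0 $$ (i, j) = (\<Sum>b<p + 1. D b * B 0 b $$ (i, j))"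
    and S_Suc: "\<And>a i j. a < q \<Longrightarrow> i < n \<Longrightarrow> j < n \<Longrightarrow>
      S (Suc a) $$ (i, j) = h a * S a $$ (i, j) + (\<Sum>b<p + 1. D b * B (Suc a) b $$ (i, j))"
  shows "z \<in> carrier_vec ((p + 1 + q) * n) \<and> z \<noteq> 0\<^sub>v ((p + 1 + q) * n) \<and>
      bidiag_pencil n p q g h B *\<^sub>v z = 0\<^sub>v ((p + 1 + q) * n) \<longleftrightarrow>
    (\<exists>v. (v \<in> carrier_vec n \<and> v \<noteq> 0\<^sub>v n \<and> S q *\<^sub>v v = 0\<^sub>v n) \<and> z = block_column n p q D S *\<^sub>v v)"
    (is "?L \<longleftrightarrow> ?R")
proof -
  note kernel = bidiag_pencil_kernel[OF _ D S S_0 S_Suc]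
  note inj = block_column_mult_vec_eq_0_iff[of _ n D p q S, OF _ D(1)]
  show ?thesis
  proof
    assume L: ?L
    then obtain v where v: "v \<in> carrier_vec n" "S q *\<^sub>v v = 0\<^sub>v n"
      "z = block_column n p q D S *\<^sub>v v"
      using kernel[of z] by auto
    moreover have "v \<noteq> 0\<^sub>v n" using inj[OF v(1)] L v(3) by simp
    ultimately show ?R by auto
  next
    assume ?R
    then obtain v where v: "v \<in> carrier_vec n" "v \<noteq> 0\<^sub>v n" "S q *\<^sub>v v = 0\<^sub>v n"
      "z = block_column n p q D S *\<^sub>v v" by auto
    have z: "z \<in> carrier_vec ((p + 1 + q) * n)" by (rule carrier_vecI) (simp add: v(4))
    moreover have "bidiag_pencil n p q g h B *\<^sub>v z = 0\<^sub>v ((p + 1 + q) * n)"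
      by (intro iffD2[OF kernel[OF z]] bexI[of _ v] conjI v)
    moreover have "z \<noteq> 0\<^sub>v ((p + 1 + q) * n)" using inj[OF v(1)] v(2,4) by simp
    ultimately show ?L by simp
  qed
qed

section \<open>Evaluation at a point and passage to left eigenvectors\<close>

lemma eval_block_column:
  assumes "\<And>a. a < q \<Longrightarrow> S a \<in> carrier_mat n n"
  shows "eval_matpoly (block_column n p q D S) z =
    block_column n p q (\<lambda>a. poly (D a) z) (\<lambda>a. eval_matpoly (S a) z)"
proof -
  have "map_mat (\<lambda>f. poly f z) (f \<cdot>\<^sub>m 1\<^sub>m n) = poly f z \<cdot>\<^sub>m 1\<^sub>m n" for f
    by (rule eq_matI) auto
  then show ?thesis
    unfolding eval_matpoly_def block_column_def
    by (subst map_block_matrix) (auto simp: assms intro!: block_matrix_cong)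
qed

text \<open>Allows \<open>S\<close> to be extended by a further value at \<open>q\<close>, which the
  column does not contain.\<close>

lemma block_column_cong:
  assumes "\<And>a. a \<le> p \<Longrightarrow> D a = D' a" "\<And>a. a < q \<Longrightarrow> S a = S' a"
  shows "block_column n p q D S = block_column n p q D' S'"
  unfolding block_column_def by (rule block_matrix_cong) (use assms in auto)

lemma eval_matpoly_dims [simp]:
  "dim_row (eval_matpoly A z) = dim_row A" "dim_col (eval_matpoly A z) = dim_col A"
  by (simp_all add: eval_matpoly_def)

lemma eval_transpose: "eval_matpoly (transpose_mat A) z = transpose_mat (eval_matpoly A z)"
  by (rule eq_matI) (auto simp: eval_matpoly_def)

text \<open>Left eigenvectors use the plain transpose, so only commutativity of the scalar product
  is involved and no conjugation appears.\<close>

lemma left_eigenvector_iff_right_transpose: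
  "left_eigenvector A z w \<longleftrightarrow> right_eigenvector (transpose_mat A) z w"
proof -
  let ?E = "eval_matpoly A z"
  have "mat_of_row w * ?E = 0\<^sub>m 1 (dim_col A) \<longleftrightarrow> transpose_mat ?E *\<^sub>v w = 0\<^sub>v (dim_col A)"
    if w: "w \<in> carrier_vec (dim_row A)"
  proof -
    have index: "(mat_of_row w * ?E) $$ (0, j) = (transpose_mat ?E *\<^sub>v w) $ j"
      if "j < dim_col A" for j
    proof -
      have "col ?E j \<in> carrier_vec (dim_row A)" by (rule carrier_vecI) simp
      with that w show ?thesis by (simp add: comm_scalar_prod[OF w])
    qed
    show ?thesis
    proof
      assume "mat_of_row w * ?E = 0\<^sub>m 1 (dim_col A)"
      then show "transpose_mat ?E *\<^sub>v w = 0\<^sub>v (dim_col A)"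
        by (intro eq_vecI) (simp_all add: index[symmetric] del: index_mult_mat_vec)
    next
      assume "transpose_mat ?E *\<^sub>v w = 0\<^sub>v (dim_col A)"
      then show "mat_of_row w * ?E = 0\<^sub>m 1 (dim_col A)"
        by (intro eq_matI) (simp_all add: index del: index_mult_mat_vec index_mult_mat(1))
    qed
  qed
  then show ?thesis
    unfolding left_eigenvector_def right_eigenvector_def eval_transpose
    by (simp cong: conj_cong)
qed

section \<open>Newton products and Horner tails\<close>

text \<open>\<open>horner_tail k x z c e\<close> is an entry of the Horner shift with index \<open>k - e\<close>; for \<open>e = 0\<close> it is
  an entry of the whole matrix polynomial.\<close>

definition horner_tail ::
    "nat \<Rightarrow> (nat \<Rightarrow> complex) \<Rightarrow> complex \<Rightarrow> (nat \<Rightarrow> complex) \<Rightarrow> nat \<Rightarrow> complex" where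
  "horner_tail k x z c e = (\<Sum>l\<in>{e..k}. poly (newton_prod x (e + 1) l) z * c l)"

lemma newton_prod_empty [simp]: "j < i \<Longrightarrow> newton_prod x i j = 1"
  by (simp add: newton_prod_def)

lemma poly_newton_prod_split:
  assumes "i \<le> e + 1" "e \<le> l"
  shows "poly (newton_prod x i l) z = poly (newton_prod x i e) z * poly (newton_prod x (e + 1) l) z"
proof -
  have "{i..l} = {i..e} \<union> {e + 1..l}" using assms by auto
  then show ?thesis by (simp add: newton_prod_def prod.union_disjoint)
qed

lemma poly_newton_prod_last:
  "i \<le> Suc j \<Longrightarrow> poly (newton_prod x i (Suc j)) z = poly (newton_prod x i j) z * (z - x (Suc j))"
  by (cases "i = Suc j") (simp_all add: newton_prod_def newton_gamma_def algebra_simps)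

text \<open>Every product with upper index \<open>l \<ge> e\<close> contains the factors numbered
  \<open>d + 1\<close> to \<open>e\<close>; pulling them out leaves the tail at \<open>e\<close>.
  The case \<open>e = Suc d\<close> is a single Horner step.\<close>

lemma horner_tail_split:
  assumes "d \<le> e" "e \<le> k"
  shows "horner_tail k x z c d = (\<Sum>l\<in>{d..<e}. poly (newton_prod x (d + 1) l) z * c l) +
    poly (newton_prod x (d + 1) e) z * horner_tail k x z c e"
proof -
  have "{d..k} = {d..<e} \<union> {e..k}" using assms by auto
  then have "horner_tail k x z c d = (\<Sum>l\<in>{d..<e}. poly (newton_prod x (d + 1) l) z * c l) +
      (\<Sum>l\<in>{e..k}. poly (newton_prod x (d + 1) l) z * c l)"
    unfolding horner_tail_def by (simp add: sum.union_disjoint ivl_disj_int)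
  also have "(\<Sum>l\<in>{e..k}. poly (newton_prod x (d + 1) l) z * c l) =
      (\<Sum>l\<in>{e..k}. poly (newton_prod x (d + 1) e) z * (poly (newton_prod x (e + 1) l) z * c l))"
    using assms
    by (intro sum.cong refl) (subst poly_newton_prod_split[where e = e], auto simp: mult.assoc)
  finally show ?thesis by (simp only: horner_tail_def sum_distrib_left)
qed

lemma horner_tail_k: "horner_tail k x z c k = c k"
  by (simp add: horner_tail_def)

lemma horner_tail_step:
  assumes "e < k"
  shows "horner_tail k x z c e = (z - x (Suc e)) * horner_tail k x z c (Suc e) + c e"
  using horner_tail_split[of e "Suc e" k x z c] assms
  by (simp add: newton_prod_def newton_gamma_def)

text \<open>Block columns list coefficients by decreasing index, Horner tails by increasing index;
  this converts one order into the other.\<close>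

lemma sum_reverse_shift:
  fixes f :: "nat \<Rightarrow> 'a :: comm_monoid_add"
  shows "(\<Sum>b<p + 1. f (m + p - b)) = (\<Sum>l\<in>{m..<m + p + 1}. f l)"
proof -
  have "(\<Sum>b<p + 1. f (m + p - b)) = (\<Sum>b<p + 1. f (m + (p + 1 - Suc b)))"
    by (intro sum.cong) auto
  also have "\<dots> = (\<Sum>b<p + 1. f (m + b))"
    by (rule sum.nat_diff_reindex)
  finally show ?thesis
    by (simp only: sum.atLeastLessThan_shift_0[of f m] lessThan_atLeast0 comp_def) simp
qed

section \<open>The Newton pencil and its columns in bidiagonal form\<close>

lemma eval_block_matrix:
  assumes "\<And>a b. a < r \<Longrightarrow> b < c \<Longrightarrow> B a b \<in> carrier_mat n n"
  shows "eval_matpoly (block_matrix n r c B) z = block_matrix n r c (\<lambda>a b. eval_matpoly (B a b) z)"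
  unfolding eval_matpoly_def by (rule map_block_matrix[OF assms])

lemma eval_bidiag: "eval_matpoly (bidiag n g a b) z = bidiag n (\<lambda>a. poly (g a) z) a b"
  by (rule eq_matI) (auto simp: eval_matpoly_def bidiag_def)

lemma eval_bidiag_pencil:
  assumes "\<And>a b. a \<le> q \<Longrightarrow> b \<le> p \<Longrightarrow> B a b \<in> carrier_mat n n"
  shows "eval_matpoly (bidiag_pencil n p q g h B) z =
    bidiag_pencil n p q (\<lambda>a. poly (g a) z) (\<lambda>a. poly (h a) z) (\<lambda>a b. eval_matpoly (B a b) z)"
proof -
  have "eval_matpoly (0\<^sub>m n n) z = 0\<^sub>m n n"
    by (rule eq_matI) (auto simp: eval_matpoly_def)
  then show ?thesis
    unfolding bidiag_pencil_eq_block
    by (subst eval_block_matrix)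
      (auto simp: assms eval_transpose eval_bidiag transpose_carrier_mat intro!: block_matrix_cong)
qed

text \<open>The block function of \<open>newton_M\<close> with \<open>k\<close> written as
  \<open>\<mu> + 1 + p\<close>, so that \<open>k - 1\<close> becomes \<open>\<mu> + p\<close> and
  \<open>k - \<mu> - 1\<close> becomes \<open>p\<close>.\<close>

definition newton_block ::
    "nat \<Rightarrow> nat \<Rightarrow> nat \<Rightarrow> (nat \<Rightarrow> complex) \<Rightarrow> (nat \<Rightarrow> complex mat) \<Rightarrow> nat \<Rightarrow> nat \<Rightarrow> complex poly mat" where
  "newton_block n p \<mu> x P a b =
    (if a = 0 \<and> b = 0
       then newton_gamma x (\<mu> + 1 + p) \<cdot>\<^sub>m const_matpoly (P (\<mu> + 1 + p)) + const_matpoly (P (\<mu> + p))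
     else if a = 0 then const_matpoly (P (\<mu> + p - b))
     else if b = p then const_matpoly (P (\<mu> - a))
     else 0\<^sub>m n n)"

lemma newton_block_carrier:
  assumes "\<And>l. l \<le> \<mu> + 1 + p \<Longrightarrow> P l \<in> carrier_mat n n"
  shows "newton_block n p \<mu> x P a b \<in> carrier_mat n n"
  using assms by (auto simp: newton_block_def const_matpoly_def)

lemma eval_newton_block_index:
  assumes "\<And>l. l \<le> \<mu> + 1 + p \<Longrightarrow> P l \<in> carrier_mat n n" "i < n" "j < n"
  shows "eval_matpoly (newton_block n p \<mu> x P a b) z $$ (i, j) =
    (if a = 0 \<and> b = 0 then (z - x (\<mu> + 1 + p)) * P (\<mu> + 1 + p) $$ (i, j) + P (\<mu> + p) $$ (i, j)
     else if a = 0 then P (\<mu> + p - b) $$ (i, j)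
     else if b = p then P (\<mu> - a) $$ (i, j) else 0)"
proof -
  have const: "const_matpoly (P l) \<in> carrier_mat n n" "const_matpoly (P l) $$ (i, j) = [:P l $$ (i, j):]"
    if "l \<le> \<mu> + 1 + p" for l
    using assms(1)[OF that] assms(2,3) by (simp_all add: const_matpoly_def)
  then show ?thesis
    using assms(2,3) carrier_matD[OF const(1)]
    by (auto simp: newton_block_def eval_matpoly_def newton_gamma_def algebra_simps)
qed

lemma newton_pencil_eq_bidiag_pencil:
  "newton_pencil n (\<mu> + 1 + p) \<mu> x P =
    bidiag_pencil n p \<mu> (\<lambda>a. newton_gamma x (\<mu> + p - a)) (\<lambda>a. newton_gamma x (\<mu> - a))
      (newton_block n p \<mu> x P)"
  by (simp add: newton_pencil_def bidiag_pencil_def newton_M_def newton_K1_def newton_K2_def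
      bidiag_def[abs_def] newton_block_def[abs_def] cong: if_cong)

lemma newton_H_eq_block_column:
  "newton_H n (\<mu> + 1 + p) \<mu> x P = block_column n p \<mu>
    (\<lambda>b. newton_prod x (\<mu> + 1) (\<mu> + p - b)) (\<lambda>a. newton_horner_shift n (\<mu> + 1 + p) x P (p + 1 + a))"
proof -
  have t: "transpose_mat (newton_D1 n (\<mu> + 1 + p) \<mu> x) = block_matrix n (p + 1) 1
      (\<lambda>a _. newton_prod x (\<mu> + 1) (\<mu> + p - a) \<cdot>\<^sub>m 1\<^sub>m n)"
    unfolding newton_D1_def
    by (subst transpose_block_matrix) (auto intro!: eq_matI intro!: block_matrix_cong)
  \<comment> \<open>\<open>append_rows\<close> pads with matrices without columns; seen as block
    matrices with zero block columns they fit the gluing lemma.\<close>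
  have z: "0\<^sub>m (dim_row (block_matrix n r 1 A)) 0 = block_matrix n r 0 A" for r and A :: "nat \<Rightarrow> nat \<Rightarrow> complex poly mat"
    by (rule eq_matI) auto
  show ?thesis
    unfolding newton_H_def t append_rows_def z four_block_block_matrix block_column_def
    unfolding add_0_right by (rule block_matrix_cong) auto
qed

text \<open>\<open>matrix_sum\<close> is \<open>n\<close> by \<open>n\<close> by construction, and a
  sum of matrices takes its dimensions from the second summand, here
  \<open>P (k - m)\<close>.\<close>

lemma newton_horner_shift_carrier:
  "P (k - m) \<in> carrier_mat n n \<Longrightarrow> newton_horner_shift n k x P m \<in> carrier_mat n n"
  by (simp add: newton_horner_shift_def matrix_sum_def const_matpoly_def)

lemma transpose_newton_G_eq_block_column:
  assumes P: "\<And>l. l \<le> \<mu> + 1 + p \<Longrightarrow> P l \<in> carrier_mat n n"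
  shows "transpose_mat (newton_G n (\<mu> + 1 + p) \<mu> x P) = block_column n \<mu> p
    (\<lambda>b. newton_prod x 1 (\<mu> - b))
    (\<lambda>b. transpose_mat (newton_prod x 1 \<mu> \<cdot>\<^sub>m newton_horner_shift n (\<mu> + 1 + p) x P (b + 1)))"
proof -
  have z: "0\<^sub>m 0 (dim_col (block_matrix n 1 c A)) = block_matrix n 0 c A"
    for c and A :: "nat \<Rightarrow> nat \<Rightarrow> complex poly mat"
    by (rule eq_matI) auto
  have G: "newton_G n (\<mu> + 1 + p) \<mu> x P = block_matrix n 1 (\<mu> + 1 + p) (\<lambda>_ b.
      if b \<le> \<mu> then newton_prod x 1 (\<mu> - b) \<cdot>\<^sub>m 1\<^sub>m n
      else newton_prod x 1 \<mu> \<cdot>\<^sub>m newton_horner_shift n (\<mu> + 1 + p) x P (b - (\<mu> + 1) + 1))"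
    unfolding newton_G_def append_columns_def newton_D2_def z four_block_block_matrix add_0_right
    by (simp add: block_matrix_def less_Suc_eq_le cong: if_cong)
  have "newton_horner_shift n (\<mu> + 1 + p) x P m \<in> carrier_mat n n" for m
    by (intro newton_horner_shift_carrier P) auto
  then show ?thesis
    unfolding G block_column_def
    by (subst transpose_block_matrix) (auto intro!: block_matrix_cong eq_matI)
qed

lemma newton_matpoly_dims [simp]:
  "dim_row (newton_matpoly n k x P) = n" "dim_col (newton_matpoly n k x P) = n"
  by (simp_all add: newton_matpoly_def matrix_sum_def)

lemma eval_newton_matpoly_index:
  assumes "\<And>l. l \<le> k \<Longrightarrow> P l \<in> carrier_mat n n" "i < n" "j < n"
  shows "eval_matpoly (newton_matpoly n k x P) z $$ (i, j) =
    horner_tail k x z (\<lambda>l. P l $$ (i, j)) 0"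
proof -
  have "(newton_prod x 1 l \<cdot>\<^sub>m const_matpoly (P l)) $$ (i, j) =
      newton_prod x 1 l * [:P l $$ (i, j):]" if "l \<in> {0..k}" for l
    using assms(1)[of l] that assms(2,3) by (simp add: const_matpoly_def)
  with assms(2,3) show ?thesis
    by (simp add: eval_matpoly_def newton_matpoly_def matrix_sum_def horner_tail_def poly_sum mult.commute)
qed

lemma eval_newton_horner_shift_index:
  assumes P: "\<And>l. l \<le> k \<Longrightarrow> P l \<in> carrier_mat n n" and ij: "i < n" "j < n" and m: "1 \<le> m" "m \<le> k"
  shows "eval_matpoly (newton_horner_shift n k x P m) z $$ (i, j) =
    horner_tail k x z (\<lambda>l. P l $$ (i, j)) (k - m)"
proof -
  define e where "e = k - m"
  have e: "k + 1 - m = Suc e" "k - m = e" "e \<le> k" using m by (auto simp: e_def)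
  have entry: "(newton_prod x (Suc e) l \<cdot>\<^sub>m const_matpoly (P l)) $$ (i, j) =
      newton_prod x (Suc e) l * [:P l $$ (i, j):]" if "l \<in> {Suc e..k}" for l
    using P[of l] that ij by (simp add: const_matpoly_def)
  have "eval_matpoly (newton_horner_shift n k x P m) z $$ (i, j) =
      (\<Sum>l\<in>{Suc e..k}. poly (newton_prod x (Suc e) l) z * P l $$ (i, j)) + P e $$ (i, j)"
    unfolding newton_horner_shift_def e using P[of e] e(3) ij entry
    by (simp add: eval_matpoly_def matrix_sum_def poly_sum const_matpoly_def mult.commute)
  \<comment> \<open>The separate summand \<open>P e\<close> is the term \<open>l = e\<close>, whose
    Newton product is empty.\<close>
  also have "\<dots> = horner_tail k x z (\<lambda>l. P l $$ (i, j)) e"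
    unfolding horner_tail_def using e(3) by (simp add: sum.atLeast_Suc_atMost[of e])
  finally show ?thesis by (simp add: e)
qed

section \<open>Right and left eigenvectors of the Newton pencil\<close>

lemma right_eigenvector_newton_pencil_iff:
  assumes P: "\<And>l. l \<le> \<mu> + 1 + p \<Longrightarrow> P l \<in> carrier_mat n n"
  shows "right_eigenvector (newton_pencil n (\<mu> + 1 + p) \<mu> x P) z\<^sub>0 z \<longleftrightarrow>
    (\<exists>v. right_eigenvector (newton_matpoly n (\<mu> + 1 + p) x P) z\<^sub>0 v \<and>
      z = eval_matpoly (newton_H n (\<mu> + 1 + p) \<mu> x P) z\<^sub>0 *\<^sub>v v)"
proof -
  let ?k = "\<mu> + 1 + p"
  let ?B = "\<lambda>a b. eval_matpoly (newton_block n p \<mu> x P a b) z\<^sub>0"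
  define D where "D b = poly (newton_prod x (\<mu> + 1) (\<mu> + p - b)) z\<^sub>0" for b
  \<comment> \<open>The Horner shifts occurring in \<open>newton_H\<close>, continued at
    \<open>a = \<mu>\<close> by the matrix polynomial, so that \<open>S \<mu>\<close> annihilating
    \<open>v\<close> is its eigenvector equation. Entrywise, \<open>S a\<close> is the tail at
    \<open>\<mu> - a\<close>.\<close>
  define S where "S a = eval_matpoly (if a < \<mu> then newton_horner_shift n ?k x P (p + 1 + a)
    else newton_matpoly n ?k x P) z\<^sub>0" for a
  let ?W = "\<lambda>i j. horner_tail ?k x z\<^sub>0 (\<lambda>l. P l $$ (i, j))"
  have shift: "newton_horner_shift n ?k x P m \<in> carrier_mat n n" for m
    by (intro newton_horner_shift_carrier P) auto
  have S_index: "S a $$ (i, j) = ?W i j (\<mu> - a)" if "a \<le> \<mu>" "i < n" "j < n" for a i j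
  proof (cases "a < \<mu>")
    case True
    have "eval_matpoly (newton_horner_shift n ?k x P (p + 1 + a)) z\<^sub>0 $$ (i, j) = ?W i j (?k - (p + 1 + a))"
      using True that by (intro eval_newton_horner_shift_index P) auto
    with True show ?thesis by (simp add: S_def)
  next
    case False
    then have "S a $$ (i, j) = ?W i j 0"
      unfolding S_def using that by (simp del: add_Suc add_Suc_right add: eval_newton_matpoly_index P)
    with False show ?thesis by simp
  qed
  have D_p: "D p = 1" by (simp add: D_def)
  have D_step: "D a = (z\<^sub>0 - x (\<mu> + p - a)) * D (Suc a)" if "a < p" for a
  proof -
    have "\<mu> + p - a = Suc (\<mu> + p - Suc a)" using that by simp
    then show ?thesis
      unfolding D_def using that poly_newton_prod_last[of "\<mu> + 1" "\<mu> + p - Suc a" x z\<^sub>0] by simp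
  qed
  have S_carrier: "S a \<in> carrier_mat n n" for a
    using shift[THEN carrier_matD(1)] shift[THEN carrier_matD(2)]
    by (intro carrier_matI) (simp_all add: S_def del: add_Suc add_Suc_right One_nat_def)
  have S_0: "S 0 $$ (i, j) = (\<Sum>b<p + 1. D b * ?B 0 b $$ (i, j))" if ij: "i < n" "j < n" for i j
  proof -
    \<comment> \<open>The top block row holds the coefficients \<open>\<mu>\<close> to
      \<open>k - 1\<close>, plus the degree-one term in the corner. Multiplied by
      \<open>D 0\<close>, the latter supplies the summand \<open>l = k\<close> of the tail at
      \<open>\<mu>\<close>.\<close>
    have "(\<Sum>b<p + 1. D b * ?B 0 b $$ (i, j)) =
        (\<Sum>b<p + 1. D b * P (\<mu> + p - b) $$ (i, j) + (if b = 0 then D 0 * (z\<^sub>0 - x ?k) * P ?k $$ (i, j) else 0))"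
      by (intro sum.cong refl, subst eval_newton_block_index[OF P ij]) (auto simp: algebra_simps)
    also have "\<dots> = (\<Sum>l\<in>{\<mu>..<\<mu> + p + 1}. poly (newton_prod x (\<mu> + 1) l) z\<^sub>0 * P l $$ (i, j)) +
        D 0 * (z\<^sub>0 - x ?k) * P ?k $$ (i, j)"
      unfolding sum.distrib D_def
      by (subst sum_reverse_shift[where f = "\<lambda>l. poly (newton_prod x (\<mu> + 1) l) z\<^sub>0 * P l $$ (i, j)"]) simp
    also have "D 0 * (z\<^sub>0 - x ?k) = poly (newton_prod x (\<mu> + 1) ?k) z\<^sub>0"
      using poly_newton_prod_last[of "\<mu> + 1" "\<mu> + p" x z\<^sub>0] by (simp add: D_def)
    also have "(\<Sum>l\<in>{\<mu>..<\<mu> + p + 1}. poly (newton_prod x (\<mu> + 1) l) z\<^sub>0 * P l $$ (i, j)) +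
        poly (newton_prod x (\<mu> + 1) ?k) z\<^sub>0 * P ?k $$ (i, j) = ?W i j \<mu>"
      by (subst horner_tail_split[of \<mu> ?k]) (simp_all add: horner_tail_k)
    finally show ?thesis using S_index[of 0 i j] ij by simp
  qed
  \<comment> \<open>Below the top row only the last block column can be nonzero, and its weight is
    \<open>D p = 1\<close>: this is one Horner step from \<open>\<mu> - a\<close> to
    \<open>\<mu> - Suc a\<close>.\<close>
  have S_Suc: "S (Suc a) $$ (i, j) =
      (z\<^sub>0 - x (\<mu> - a)) * S a $$ (i, j) + (\<Sum>b<p + 1. D b * ?B (Suc a) b $$ (i, j))"
    if "a < \<mu>" "i < n" "j < n" for a i j
  proof -
    have "(\<Sum>b<p + 1. D b * ?B (Suc a) b $$ (i, j)) =
        (\<Sum>b<p + 1. if b = p then P (\<mu> - Suc a) $$ (i, j) else 0)"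
      by (intro sum.cong refl, subst eval_newton_block_index[OF P that(2,3)]) (auto simp: D_p)
    moreover have "Suc (\<mu> - Suc a) = \<mu> - a" using that by simp
    ultimately show ?thesis
      using that horner_tail_step[of "\<mu> - Suc a" ?k x z\<^sub>0 "\<lambda>l. P l $$ (i, j)"] by (simp add: S_index)
  qed
  have N: "eval_matpoly (newton_pencil n ?k \<mu> x P) z\<^sub>0 =
      bidiag_pencil n p \<mu> (\<lambda>a. z\<^sub>0 - x (\<mu> + p - a)) (\<lambda>a. z\<^sub>0 - x (\<mu> - a)) ?B"
    unfolding newton_pencil_eq_bidiag_pencil
    by (subst eval_bidiag_pencil) (simp_all add: newton_block_carrier P newton_gamma_def)
  have H: "eval_matpoly (newton_H n ?k \<mu> x P) z\<^sub>0 = block_column n p \<mu> D S"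
    unfolding newton_H_eq_block_column
    by (subst eval_block_column[OF shift]) (auto simp: D_def S_def intro!: block_column_cong)
  have dims: "dim_row (newton_pencil n ?k \<mu> x P) = (p + 1 + \<mu>) * n"
    "dim_col (newton_pencil n ?k \<mu> x P) = (p + 1 + \<mu>) * n"
    unfolding newton_pencil_eq_bidiag_pencil by (simp_all add: distrib_right)
  have Q: "eval_matpoly (newton_matpoly n ?k x P) z\<^sub>0 = S \<mu>"
    by (simp add: S_def)
  show ?thesis
    unfolding right_eigenvector_def N H dims Q newton_matpoly_dims
    by (rule bidiag_pencil_null_vector_iff[OF D_p D_step S_carrier S_0 S_Suc])
qed

text \<open>The kernel result is applied to the transposed pencil, with \<open>p\<close> and
  \<open>\<mu>\<close> exchanged. The first block column of \<open>newton_M\<close> now comes first;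
  its corner has weight \<open>D 0\<close>, which is the factor \<open>newton_prod x 1 \<mu>\<close>
  carried by the shifts in \<open>newton_G\<close>.\<close>

lemma left_eigenvector_newton_pencil_iff:
  assumes P: "\<And>l. l \<le> \<mu> + 1 + p \<Longrightarrow> P l \<in> carrier_mat n n"
  shows "left_eigenvector (newton_pencil n (\<mu> + 1 + p) \<mu> x P) z\<^sub>0 w \<longleftrightarrow>
    (\<exists>y. left_eigenvector (newton_matpoly n (\<mu> + 1 + p) x P) z\<^sub>0 y \<and>
      w = transpose_mat (eval_matpoly (newton_G n (\<mu> + 1 + p) \<mu> x P) z\<^sub>0) *\<^sub>v y)"
proof -
  let ?k = "\<mu> + 1 + p"
  let ?B = "\<lambda>a b. transpose_mat (eval_matpoly (newton_block n p \<mu> x P b a) z\<^sub>0)"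
  let ?n = "\<lambda>l. poly (newton_prod x 1 l) z\<^sub>0"
  define D where "D b = ?n (\<mu> - b)" for b
  define S where "S a = transpose_mat (eval_matpoly (if a < p
    then newton_prod x 1 \<mu> \<cdot>\<^sub>m newton_horner_shift n ?k x P (a + 1)
    else newton_matpoly n ?k x P) z\<^sub>0)" for a
  let ?W = "\<lambda>i j. horner_tail ?k x z\<^sub>0 (\<lambda>l. P l $$ (j, i))"
  have shift: "newton_horner_shift n ?k x P m \<in> carrier_mat n n" for m
    by (intro newton_horner_shift_carrier P) auto
  have S_carrier: "S a \<in> carrier_mat n n" for a
    using shift[THEN carrier_matD(1)] shift[THEN carrier_matD(2)]
    by (intro carrier_matI) (simp_all add: S_def del: add_Suc add_Suc_right One_nat_def)
  have S_index: "S a $$ (i, j) = ?n \<mu> * ?W i j (\<mu> + p - a)" if "a < p" "i < n" "j < n" for a i j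
  proof -
    have "eval_matpoly (newton_horner_shift n ?k x P (a + 1)) z\<^sub>0 $$ (j, i) = ?W i j (?k - (a + 1))"
      using that by (intro eval_newton_horner_shift_index P) auto
    moreover have "S a $$ (i, j) = ?n \<mu> * eval_matpoly (newton_horner_shift n ?k x P (a + 1)) z\<^sub>0 $$ (j, i)"
      using that shift[of "a + 1"] by (simp add: S_def eval_matpoly_def)
    ultimately show ?thesis by simp
  qed
  have S_p_index: "S p $$ (i, j) = ?W i j 0" if "i < n" "j < n" for i j
    unfolding S_def using that by (simp del: add_Suc add_Suc_right add: eval_newton_matpoly_index P)
  have B_index: "?B a b $$ (i, j) =
    (if a = 0 \<and> b = 0 then (z\<^sub>0 - x ?k) * P ?k $$ (j, i) + P (\<mu> + p) $$ (j, i)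
     else if b = 0 then P (\<mu> + p - a) $$ (j, i)
     else if a = p then P (\<mu> - b) $$ (j, i) else 0)" if ij: "i < n" "j < n" for a b i j
  proof -
    have "?B a b $$ (i, j) = eval_matpoly (newton_block n p \<mu> x P b a) z\<^sub>0 $$ (j, i)"
      using carrier_matD[OF newton_block_carrier[OF P], where x1 = x] ij by simp
    then show ?thesis
      by (simp only: eval_newton_block_index[OF P ij(2,1)] conj_commute)
  qed
  have D_\<mu>: "D \<mu> = 1" by (simp add: D_def)
  have D_step: "D a = (z\<^sub>0 - x (\<mu> - a)) * D (Suc a)" if "a < \<mu>" for a
  proof -
    have "\<mu> - a = Suc (\<mu> - Suc a)" using that by simp
    then show ?thesis
      unfolding D_def using poly_newton_prod_last[of 1 "\<mu> - Suc a" x z\<^sub>0] by simp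
  qed
  have D_sum: "(\<Sum>b<\<mu> + 1. D b * P (\<mu> - b) $$ (j, i)) = (\<Sum>l\<in>{0..<\<mu> + 1}. ?n l * P l $$ (j, i))" for i j
    using sum_reverse_shift[of "\<lambda>l. ?n l * P l $$ (j, i)" 0 \<mu>] by (simp only: D_def add_0)
  \<comment> \<open>For \<open>p = 0\<close> the first block column of \<open>newton_M\<close> is
    also the last, and the sum is already the whole matrix polynomial. Otherwise only the corner
    block contributes, giving the first Horner shift.\<close>
  have S_0: "S 0 $$ (i, j) = (\<Sum>b<\<mu> + 1. D b * ?B 0 b $$ (i, j))" if ij: "i < n" "j < n" for i j
  proof (cases "p = 0")
    case True
    have "(\<Sum>b<\<mu> + 1. D b * ?B 0 b $$ (i, j)) =
        (\<Sum>b<\<mu> + 1. D b * P (\<mu> - b) $$ (j, i) + (if b = 0 then D 0 * (z\<^sub>0 - x ?k) * P ?k $$ (j, i) else 0))"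
      by (intro sum.cong refl, subst B_index[OF ij]) (auto simp: algebra_simps True)
    also have "\<dots> = (\<Sum>l\<in>{0..<\<mu> + 1}. ?n l * P l $$ (j, i)) + D 0 * (z\<^sub>0 - x ?k) * P ?k $$ (j, i)"
      unfolding sum.distrib D_sum by simp
    also have "D 0 * (z\<^sub>0 - x ?k) = ?n ?k"
      using poly_newton_prod_last[of 1 \<mu> x z\<^sub>0] by (simp add: D_def True)
    also have "(\<Sum>l\<in>{0..<\<mu> + 1}. ?n l * P l $$ (j, i)) + ?n ?k * P ?k $$ (j, i) = ?W i j 0"
      by (subst horner_tail_split[of 0 ?k]) (simp_all add: horner_tail_k True)
    finally show ?thesis using S_p_index ij True by simp
  next
    case False
    have "(\<Sum>b<\<mu> + 1. D b * ?B 0 b $$ (i, j)) = (\<Sum>b<\<mu> + 1. if b = 0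
        then ?n \<mu> * ((z\<^sub>0 - x ?k) * P ?k $$ (j, i) + P (\<mu> + p) $$ (j, i)) else 0)"
      using False by (intro sum.cong refl, subst B_index[OF ij]) (auto simp: D_def)
    also have "\<dots> = ?n \<mu> * ?W i j (\<mu> + p)"
      using horner_tail_step[of "\<mu> + p" ?k x z\<^sub>0 "\<lambda>l. P l $$ (j, i)"]
        horner_tail_k[of ?k x z\<^sub>0 "\<lambda>l. P l $$ (j, i)"] by simp
    finally show ?thesis using S_index[of 0] ij False by simp
  qed
  have S_Suc: "S (Suc a) $$ (i, j) =
      (z\<^sub>0 - x (\<mu> + p - a)) * S a $$ (i, j) + (\<Sum>b<\<mu> + 1. D b * ?B (Suc a) b $$ (i, j))"
    if a: "a < p" and ij: "i < n" "j < n" for a i j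
  proof (cases "Suc a = p")
    case True
    \<comment> \<open>The last block column contributes all terms with \<open>l \<le> \<mu>\<close>.
      The others form the tail at \<open>Suc \<mu>\<close> times the product of the first
      \<open>Suc \<mu>\<close> factors, and \<open>S a\<close> lacks just the last of these.\<close>
    have "(\<Sum>b<\<mu> + 1. D b * ?B (Suc a) b $$ (i, j)) = (\<Sum>l\<in>{0..<\<mu> + 1}. ?n l * P l $$ (j, i))"
      unfolding D_sum[symmetric]
      by (intro sum.cong refl, subst B_index[OF ij]) (auto simp: True[symmetric])
    moreover have "\<mu> + p - a = Suc \<mu>" using True by simp
    moreover have "?W i j 0 = (\<Sum>l\<in>{0..<\<mu> + 1}. ?n l * P l $$ (j, i)) +
        (z\<^sub>0 - x (Suc \<mu>)) * (?n \<mu> * ?W i j (Suc \<mu>))"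
      using horner_tail_split[of 0 "Suc \<mu>" ?k x z\<^sub>0 "\<lambda>l. P l $$ (j, i)"]
        poly_newton_prod_last[of 1 \<mu> x z\<^sub>0] by simp
    ultimately show ?thesis
      using S_index[OF a ij] S_p_index[OF ij] by (simp only: True add.commute)
  next
    case False
    \<comment> \<open>An intermediate column has only its top block, weighted by \<open>D 0\<close>:
      a Horner step with the common factor \<open>newton_prod x 1 \<mu>\<close> kept
      throughout.\<close>
    have "(\<Sum>b<\<mu> + 1. D b * ?B (Suc a) b $$ (i, j)) =
        (\<Sum>b<\<mu> + 1. if b = 0 then ?n \<mu> * P (\<mu> + p - Suc a) $$ (j, i) else 0)"
      using False by (intro sum.cong refl, subst B_index[OF ij]) (auto simp: D_def)
    also have "\<dots> = ?n \<mu> * P (\<mu> + p - Suc a) $$ (j, i)" by (subst sum.delta) auto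
    finally have sum: "(\<Sum>b<\<mu> + 1. D b * ?B (Suc a) b $$ (i, j)) = ?n \<mu> * P (\<mu> + p - Suc a) $$ (j, i)" .
    have "Suc (\<mu> + p - Suc a) = \<mu> + p - a" using a by simp
    then have W: "?W i j (\<mu> + p - Suc a) =
        (z\<^sub>0 - x (\<mu> + p - a)) * ?W i j (\<mu> + p - a) + P (\<mu> + p - Suc a) $$ (j, i)"
      using horner_tail_step[of "\<mu> + p - Suc a" ?k x z\<^sub>0 "\<lambda>l. P l $$ (j, i)"] by simp
    have "S (Suc a) $$ (i, j) = ?n \<mu> * ?W i j (\<mu> + p - Suc a)"
      using a False ij by (intro S_index) auto
    then show ?thesis
      unfolding sum W S_index[OF a ij] by (simp only: distrib_left mult.left_commute)
  qed
  have N: "eval_matpoly (transpose_mat (newton_pencil n ?k \<mu> x P)) z\<^sub>0 =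
      bidiag_pencil n \<mu> p (\<lambda>a. z\<^sub>0 - x (\<mu> - a)) (\<lambda>a. z\<^sub>0 - x (\<mu> + p - a)) ?B"
    unfolding newton_pencil_eq_bidiag_pencil
    by (subst transpose_bidiag_pencil, simp_all only: newton_block_carrier P, subst eval_bidiag_pencil)
      (simp_all add: newton_block_carrier P newton_gamma_def eval_transpose)
  have T: "transpose_mat (newton_prod x 1 \<mu> \<cdot>\<^sub>m newton_horner_shift n ?k x P (b + 1)) \<in> carrier_mat n n" for b
    using shift by (intro transpose_carrier_mat[THEN iffD2] smult_carrier_mat)
  have G: "transpose_mat (eval_matpoly (newton_G n ?k \<mu> x P) z\<^sub>0) = block_column n \<mu> p D S"
    unfolding eval_transpose[symmetric]
    by (subst transpose_newton_G_eq_block_column[OF P], assumption, subst eval_block_column[OF T])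
      (auto simp: D_def S_def eval_transpose intro!: block_column_cong)
  have dims: "dim_row (newton_pencil n ?k \<mu> x P) = (\<mu> + 1 + p) * n"
    "dim_col (newton_pencil n ?k \<mu> x P) = (\<mu> + 1 + p) * n"
    unfolding newton_pencil_eq_bidiag_pencil by (simp_all add: distrib_right)
  have Q: "eval_matpoly (transpose_mat (newton_matpoly n ?k x P)) z\<^sub>0 = S p"
    by (simp add: S_def eval_transpose)
  show ?thesis
    unfolding left_eigenvector_iff_right_transpose right_eigenvector_def N G dims Q
      index_transpose_mat newton_matpoly_dims
    by (rule bidiag_pencil_null_vector_iff[OF D_\<mu> D_step S_carrier S_0 S_Suc])
qed

theorem theorem3p9:
  fixes n k \<mu> :: nat
    and x :: "nat \<Rightarrow> complex"
    and P :: "nat \<Rightarrow> complex mat"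
    and z\<^sub>0 :: complex
  assumes "n \<ge> 1" and "k \<ge> 1" and "\<mu> \<le> k - 1"
    and "inj_on x {1..k}"
    and "\<And>i. i \<le> k \<Longrightarrow> P i \<in> carrier_mat n n"
    and "regular_matpoly (newton_matpoly n k x P)"
    and "finite_eigenvalue (newton_matpoly n k x P) z\<^sub>0"
  shows "(\<forall>z. right_eigenvector (newton_pencil n k \<mu> x P) z\<^sub>0 z \<longleftrightarrow>
            (\<exists>v. right_eigenvector (newton_matpoly n k x P) z\<^sub>0 v \<and>
                 z = eval_matpoly (newton_H n k \<mu> x P) z\<^sub>0 *\<^sub>v v)) \<and>
         (\<forall>w. left_eigenvector (newton_pencil n k \<mu> x P) z\<^sub>0 w \<longleftrightarrow>
            (\<exists>y. left_eigenvector (newton_matpoly n k x P) z\<^sub>0 y \<and>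
                 w = transpose_mat (eval_matpoly (newton_G n k \<mu> x P) z\<^sub>0) *\<^sub>v y))"
proof -
  define p where "p = k - \<mu> - 1"
  \<comment> \<open>\<open>k \<ge> 1\<close> excludes \<open>\<mu> = k = 0\<close>, which truncated
    subtraction would otherwise admit.\<close>
  have k: "k = \<mu> + 1 + p" using assms(2,3) by (simp add: p_def)
  show ?thesis
    using right_eigenvector_newton_pencil_iff[of \<mu> p P n x z\<^sub>0]
      left_eigenvector_newton_pencil_iff[of \<mu> p P n x z\<^sub>0] assms(5)
    unfolding k by blast
qed

end
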